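(* Let $K\colon X\times X\to\mathbb F$ be a Mercer kernel on the compact metric space $X$, let $\mathcal H_K$ be the reproducing kernel Hilbert space on $X$ with reproducing kernel $K$, and let $(e_n)_n$ be an orthonormal basis of $\mathcal H_K$. Then $$K(x,y)=\sum_{n\in\mathbb N}e_n(x)\overline{e_n(y)},\quad x,y\in X,$$ where the convergence of the series is absolute and uniform on $X\times X$.
   Context: $\mathbb F$ is either $\mathbb R$ or $\mathbb C$. A kernel $K\colon X\times X\to\mathbb F$ is Hermitian/symmetric if $K(y,x)=\overline{K(x,y)}$ for all $x,y$, and positive semidefinite if $\sum_{i,j=1}^n\overline{\alpha_i}\alpha_jK(x_i,x_j)\geq0$ for all $n\in\mathbb N$, $x_i\in X$, $\alpha_i\in\mathbb F$. A Mercer kernel on a compact metric space is a kernel that is continuous, Hermitian/symmetric and positive semidefinite. A reproducing kernel Hilbert space on $X$ with reproducing kernel $K$ is a Hilbert space $\mathcal H$ which is a vector subspace of the space of all functions $X\to\mathbb F$, such that $K_x:=K(\cdot,x)\in\mathcal H$ for all $x\in X$ and $f(x)=\langle f,K_x\rangle_{\mathcal H}$ for all $f\in\mathcal H$, $x\in X$. To each Hermitian/symmetric positive semidefinite kernel $K$ there corresponds a unique such space, denoted $\mathcal H_K$. For a Mercer kernel $\mathcal H_K$ is separable, so its orthonormal bases are countable; if $\mathcal H_K$ is finite dimensional, the series is a finite sum. *)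

theory Defs
  imports "HOL-Analysis.Analysis" "HOL-Library.Function_Algebras"
begin

text \<open>
  The scalar field is the real or the complex field, with its conjugation. By the Gelfand-Mazur
  theorem every \<^class>\<open>real_normed_field\<close> (whose norm is multiplicative) is isometrically isomorphic
  to one of these two, and the axioms determine \<open>scnj\<close>. So the class is just a way to treat the
  two cases uniformly.
\<close>

class real_or_complex = real_normed_field + banach +
  fixes scnj :: "'a \<Rightarrow> 'a"
  assumes scnj_add: "scnj (a + b) = scnj a + scnj b"
    and scnj_mult: "scnj (a * b) = scnj a * scnj b"
    and mult_scnj: "a * scnj a = (norm a)\<^sup>2 *\<^sub>R 1"

instantiation real :: real_or_complex
begin
definition scnj_real :: "real \<Rightarrow> real" where "scnj_real a = a"
instance by standard (simp_all add: scnj_real_def power2_eq_square)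
end

instantiation complex :: real_or_complex
begin
definition scnj_complex :: "complex \<Rightarrow> complex" where "scnj_complex = cnj"
instance by standard (simp_all add: scnj_complex_def complex_norm_square scaleR_conv_of_real del: of_real_power)
end

definition hermitian_kernel :: "('x \<Rightarrow> 'x \<Rightarrow> 'f::real_or_complex) \<Rightarrow> bool" where
  "hermitian_kernel K \<longleftrightarrow> (\<forall>x y. K y x = scnj (K x y))"

definition psd_kernel :: "('x \<Rightarrow> 'x \<Rightarrow> 'f::real_or_complex) \<Rightarrow> bool" where
  "psd_kernel K \<longleftrightarrow> (\<forall>(n::nat) (x :: nat \<Rightarrow> 'x) (\<alpha> :: nat \<Rightarrow> 'f).
     (\<Sum>i=1..n. \<Sum>j=1..n. scnj (\<alpha> i) * \<alpha> j * K (x i) (x j)) \<in> \<real>\<^sub>\<ge>\<^sub>0)"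

definition mercer_kernel :: "('x::metric_space \<Rightarrow> 'x \<Rightarrow> 'f::real_or_complex) \<Rightarrow> bool" where
  "mercer_kernel K \<longleftrightarrow>
     continuous_on UNIV (\<lambda>(x, y). K x y) \<and> hermitian_kernel K \<and> psd_kernel K"

text \<open>
  The vector space of all scalar functions on a type: addition is the pointwise one of
  \<^theory>\<open>HOL-Library.Function_Algebras\<close>, scalar multiplication is \<open>fscale\<close>.
\<close>

definition fscale :: "'f::real_or_complex \<Rightarrow> ('x \<Rightarrow> 'f) \<Rightarrow> 'x \<Rightarrow> 'f" where
  "fscale c f = (\<lambda>x. c * f x)"

lemma vector_space_fscale: "vector_space (fscale :: 'f::real_or_complex \<Rightarrow> ('x \<Rightarrow> 'f) \<Rightarrow> 'x \<Rightarrow> 'f)"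
  by standard (auto simp: fscale_def fun_eq_iff algebra_simps)

text \<open>
  The inner product \<open>ip\<close> is a total function of which only the values on \<open>H\<close> matter. On \<open>H\<close> the
  number \<open>ip f f\<close> is real and nonnegative, so \<open>norm (ip f f)\<close> below is \<open>ip f f\<close> as a real.
\<close>

definition ip_norm :: "(('x \<Rightarrow> 'f::real_or_complex) \<Rightarrow> ('x \<Rightarrow> 'f) \<Rightarrow> 'f) \<Rightarrow> ('x \<Rightarrow> 'f) \<Rightarrow> real" where
  "ip_norm ip f = sqrt (norm (ip f f))"

locale hilbert_function_space =
  fixes H :: "('x \<Rightarrow> 'f::real_or_complex) set"
    and ip :: "('x \<Rightarrow> 'f) \<Rightarrow> ('x \<Rightarrow> 'f) \<Rightarrow> 'f"
  assumes subspace_H: "module.subspace fscale H"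
    and ip_add_left: "\<And>f g h. f \<in> H \<Longrightarrow> g \<in> H \<Longrightarrow> h \<in> H \<Longrightarrow> ip (f + g) h = ip f h + ip g h"
    and ip_scale_left: "\<And>c f g. f \<in> H \<Longrightarrow> g \<in> H \<Longrightarrow> ip (fscale c f) g = c * ip f g"
    and ip_commute: "\<And>f g. f \<in> H \<Longrightarrow> g \<in> H \<Longrightarrow> ip g f = scnj (ip f g)"
    and ip_nonneg: "\<And>f. f \<in> H \<Longrightarrow> ip f f \<in> \<real>\<^sub>\<ge>\<^sub>0"
    and ip_definite: "\<And>f. f \<in> H \<Longrightarrow> ip f f = 0 \<Longrightarrow> f = 0"
    and complete_H: "\<And>u :: nat \<Rightarrow> 'x \<Rightarrow> 'f. range u \<subseteq> H \<Longrightarrow>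
        (\<forall>\<epsilon>>0. \<exists>N. \<forall>m\<ge>N. \<forall>n\<ge>N. ip_norm ip (u m - u n) < \<epsilon>) \<Longrightarrow>
        \<exists>f\<in>H. (\<lambda>n. ip_norm ip (u n - f)) \<longlonglongrightarrow> 0"

locale rkhs = hilbert_function_space H ip
  for H :: "('x \<Rightarrow> 'f::real_or_complex) set"
    and ip :: "('x \<Rightarrow> 'f) \<Rightarrow> ('x \<Rightarrow> 'f) \<Rightarrow> 'f" +
  fixes K :: "'x \<Rightarrow> 'x \<Rightarrow> 'f"
  assumes kernel_in_H: "\<And>x. (\<lambda>t. K t x) \<in> H"
    and reproducing: "\<And>f x. f \<in> H \<Longrightarrow> f x = ip f (\<lambda>t. K t x)"

text \<open>
  Orthonormal basis in the Hilbert space sense: an orthonormal family whose linear span is dense.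
\<close>

definition orthonormal_basis ::
    "('x \<Rightarrow> 'f::real_or_complex) set \<Rightarrow> (('x \<Rightarrow> 'f) \<Rightarrow> ('x \<Rightarrow> 'f) \<Rightarrow> 'f) \<Rightarrow>
     'i set \<Rightarrow> ('i \<Rightarrow> 'x \<Rightarrow> 'f) \<Rightarrow> bool" where
  "orthonormal_basis H ip I e \<longleftrightarrow>
     (\<forall>n\<in>I. e n \<in> H) \<and>
     (\<forall>m\<in>I. \<forall>n\<in>I. ip (e m) (e n) = (if m = n then 1 else 0)) \<and>
     (\<forall>f\<in>H. \<forall>\<epsilon>>0. \<exists>g\<in>module.span fscale (e ` I). ip_norm ip (f - g) < \<epsilon>)"

end

theory Submission
  imports Defs
begin

text \<open>
  Write \<open>K\<^sub>y\<close> for the kernel section \<open>\<lambda>t. K t y\<close> and \<open>R\<^sub>F(y)\<close> for its component orthogonal to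
  the span of \<open>(e\<^sub>n)\<close>, \<open>n \<in> F\<close>. By the reproducing property \<open>e\<^sub>n(y)\<close> is conjugate to the \<open>n\<close>-th
  coefficient of \<open>K\<^sub>y\<close>, so the error \<open>K(x,y) - \<Sum>\<^sub>F e\<^sub>n(x) cnj(e\<^sub>n(y))\<close> of a partial sum is
  \<open>R\<^sub>F(y)(x) = \<langle>R\<^sub>F(y), R\<^sub>F(x)\<rangle>\<close>, bounded by \<open>\<parallel>R\<^sub>F(x)\<parallel> \<parallel>R\<^sub>F(y)\<parallel>\<close>. The squared norm
  \<open>\<parallel>R\<^sub>F(x)\<parallel>\<^sup>2 = K(x,x) - \<Sum>\<^sub>F |e\<^sub>n(x)|\<^sup>2\<close> decreases to \<open>0\<close> pointwise and is continuous in \<open>x\<close>,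
  hence it tends to \<open>0\<close> uniformly by Dini's theorem.
\<close>

section \<open>Conjugation on the scalar field\<close>

lemma scnj_0 [simp]: "scnj 0 = (0::'f::real_or_complex)"
  using scnj_add[of "0::'f" 0] by simp

lemma scnj_minus: "scnj (- a) = - scnj (a::'f::real_or_complex)"
  using scnj_add[of a "- a"] by (simp add: eq_neg_iff_add_eq_0 add.commute)

lemma scnj_diff: "scnj (a - b) = scnj a - scnj (b::'f::real_or_complex)"
  using scnj_add[of a "- b"] by (simp add: scnj_minus)

lemma mult_scnj_of_real: "a * scnj a = of_real ((norm (a::'f::real_or_complex))\<^sup>2)"
  by (simp add: mult_scnj scaleR_conv_of_real)

text \<open>Taking norms in \<open>mult_scnj\<close> gives norm a * norm (\<open>scnj a\<close>) =
  (norm a)^2, from which a nonzero factor cancels.\<close>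

lemma norm_scnj [simp]: "norm (scnj a) = norm (a::'f::real_or_complex)"
proof (cases "a = 0")
  case False
  have "norm a * norm (scnj a) = norm a * norm a"
    by (metis mult_scnj_of_real norm_mult norm_of_real abs_power2 abs_norm_cancel power2_eq_square)
  then show ?thesis using False by simp
qed simp

lemma scnj_of_real [simp]: "scnj (of_real r) = (of_real r :: 'f::real_or_complex)"
proof (cases "r = 0")
  case False
  have "of_real r * scnj (of_real r) = (of_real r * of_real r :: 'f)"
    by (simp add: mult_scnj_of_real power2_eq_square flip: of_real_mult)
  then show ?thesis using False by simp
qed simp

lemma sum_fun_apply: "(\<Sum>i\<in>A. f i) x = (\<Sum>i\<in>A. f i x :: 'b::comm_monoid_add)"
  by (induction A rule: infinite_finite_induct) simp_all

interpretation fun_space: vector_space "fscale :: 'f::real_or_complex \<Rightarrow> ('x \<Rightarrow> 'f) \<Rightarrow> 'x \<Rightarrow> 'f"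
  by (rule vector_space_fscale)

section \<open>Inner product algebra and the Cauchy-Schwarz inequality\<close>

context hilbert_function_space
begin

lemmas zero_in = fun_space.subspace_0[OF subspace_H]
  and add_in = fun_space.subspace_add[OF subspace_H]
  and diff_in = fun_space.subspace_diff[OF subspace_H]
  and scale_in = fun_space.subspace_scale[OF subspace_H]
  and sum_in = fun_space.subspace_sum[OF subspace_H]

lemma ip_diff_left:
  assumes "f \<in> H" "g \<in> H" "h \<in> H"
  shows "ip (f - g) h = ip f h - ip g h"
  using ip_add_left[of "f - g" g h] assms by (simp add: diff_in algebra_simps)

lemma ip_zero_left: "h \<in> H \<Longrightarrow> ip 0 h = 0"
  using ip_diff_left[of h h h] by simp

lemma ip_sum_left:
  assumes "\<And>i. i \<in> A \<Longrightarrow> f i \<in> H" "h \<in> H"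
  shows "ip (\<Sum>i\<in>A. f i) h = (\<Sum>i\<in>A. ip (f i) h)"
  using assms(1)
proof (induction A rule: infinite_finite_induct)
  case (insert i A)
  then have "ip (f i + (\<Sum>i\<in>A. f i)) h = ip (f i) h + ip (\<Sum>i\<in>A. f i) h"
    by (intro ip_add_left sum_in assms(2)) auto
  also have "ip (\<Sum>i\<in>A. f i) h = (\<Sum>i\<in>A. ip (f i) h)"
    by (rule insert.IH) (simp add: insert.prems)
  finally show ?case
    by (simp only: sum.insert[OF insert.hyps])
qed (simp_all add: ip_zero_left[OF assms(2)])

lemma ip_diff_right:
  assumes "f \<in> H" "g \<in> H" "h \<in> H"
  shows "ip f (g - h) = ip f g - ip f h"
  using assms ip_commute[of "g - h" f] ip_commute[of g f] ip_commute[of h f]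
  by (simp add: diff_in ip_diff_left scnj_diff)

lemma ip_scale_right:
  assumes "f \<in> H" "g \<in> H"
  shows "ip f (fscale c g) = scnj c * ip f g"
  using assms ip_commute[of "fscale c g" f] ip_commute[of g f]
  by (simp add: scale_in ip_scale_left scnj_mult)

lemma ip_self: "f \<in> H \<Longrightarrow> ip f f = of_real ((ip_norm ip f)\<^sup>2)"
  using ip_nonneg[of f] by (auto simp: nonneg_Reals_def ip_norm_def)

lemma ip_norm_nonneg: "0 \<le> ip_norm ip f"
  by (simp add: ip_norm_def)

text \<open>Combined with minimality of the span, this extends orthogonality from single basis
  vectors to everything they span.\<close>

lemma subspace_orthogonal:
  assumes "r \<in> H"
  shows "fun_space.subspace {h \<in> H. ip h r = 0}"
  using assms
  by (auto intro!: fun_space.subspaceI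
      simp: zero_in add_in scale_in ip_zero_left ip_add_left ip_scale_left)

lemma Cauchy_Schwarz:
  assumes f: "f \<in> H" and g: "g \<in> H"
  shows "norm (ip f g) \<le> ip_norm ip f * ip_norm ip g"
proof (cases "ip_norm ip g = 0")
  case True
  then have "g = 0"
    using ip_self[OF g] ip_definite[OF g] by simp
  then have "ip f g = 0"
    using ip_commute[of g f] ip_zero_left[OF f] assms by simp
  then show ?thesis by (simp add: ip_norm_nonneg)
next
  case False
  define a d c where "a = (ip_norm ip f)\<^sup>2" and "d = (ip_norm ip g)\<^sup>2" and "c = ip f g"
  \<comment> \<open>Up to the factor \<open>d\<close>, \<open>u\<close> is the component of
    \<open>f\<close> orthogonal to \<open>g\<close>; scaling by \<open>d\<close> avoids a division.
    The inequality is read off from <u,u> \<ge> 0.\<close>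
  define u where "u = fscale (of_real d) f - fscale c g"
  have d: "d > 0"
    using False by (simp add: d_def)
  have ips: "ip f f = of_real a" "ip g g = of_real d" "ip f g = c" "ip g f = scnj c"
    using assms by (simp_all add: ip_self a_def d_def c_def ip_commute[of f g])
  have cc: "c * scnj c = of_real ((norm c)\<^sup>2)"
    by (rule mult_scnj_of_real)
  have u: "u \<in> H"
    unfolding u_def by (intro diff_in scale_in assms)
  have "ip u u = of_real d * of_real d * of_real a - of_real d * (c * scnj c)"
    using assms unfolding u_def
    by (simp add: ip_diff_left ip_diff_right ip_scale_left ip_scale_right scale_in diff_in ips
        algebra_simps)
  also have "\<dots> = of_real (d * (d * a - (norm c)\<^sup>2))"
    by (simp add: cc algebra_simps)
  finally have "(of_real ((ip_norm ip u)\<^sup>2) :: 'f) = of_real (d * (d * a - (norm c)\<^sup>2))"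
    using ip_self[OF u] by simp
  then have "(ip_norm ip u)\<^sup>2 = d * (d * a - (norm c)\<^sup>2)"
    by (simp only: of_real_eq_iff)
  then have "0 \<le> d * (d * a - (norm c)\<^sup>2)"
    by (metis zero_le_power2)
  then have "(norm c)\<^sup>2 \<le> (ip_norm ip f * ip_norm ip g)\<^sup>2"
    using d by (simp add: zero_le_mult_iff a_def d_def power_mult_distrib mult.commute)
  then show ?thesis
    by (simp add: power2_le_iff_abs_le ip_norm_nonneg c_def)
qed

end

section \<open>Reproducing property and continuity of the functions in \<open>H\<close>\<close>

context rkhs
begin

lemma ip_kernel: "f \<in> H \<Longrightarrow> ip f (\<lambda>t. K t x) = f x"
  by (simp add: reproducing)

end

text \<open>By the reproducing property f(y) - f(x) = <f, K_y - K_x>, so Cauchy-Schwarz bounds the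
  difference by the norm of \<open>f\<close> times \<open>D y\<close>. Here \<open>D y\<close> is
  the norm of K_y - K_x, which is expressed through values of the kernel and hence is continuous in
  y and zero at y = x.\<close>

lemma continuous_on_in_H:
  fixes f :: "'x::topological_space \<Rightarrow> 'f::real_or_complex"
  assumes "rkhs H ip K"
    and cont: "continuous_on UNIV (\<lambda>(x, y). K x y)" and f: "f \<in> H"
  shows "continuous_on UNIV f"
  unfolding continuous_on_def
proof
  interpret rkhs H ip K by fact
  fix x :: 'x
  define D where "D y = sqrt (norm (K y y - K y x - (K x y - K x x)))" for y
  have K_comp: "continuous_on UNIV (\<lambda>y. K (g y) (h y))"
    if "continuous_on UNIV g" "continuous_on UNIV h" for g h :: "'x \<Rightarrow> 'x"
    using continuous_on_compose2[OF cont continuous_on_Pair[OF that]] by simp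
  have "continuous_on UNIV D"
    unfolding D_def by (intro continuous_intros K_comp)
  then have "(D \<longlongrightarrow> D x) (at x)"
    by (simp add: continuous_on_def)
  then have lim: "((\<lambda>y. ip_norm ip f * D y) \<longlongrightarrow> 0) (at x)"
    using tendsto_mult_left[of D 0 "at x"] by (simp add: D_def)
  have "norm (f y - f x) \<le> ip_norm ip f * D y" for y
  proof -
    let ?k = "(\<lambda>t. K t y) - (\<lambda>t. K t x)"
    have k: "?k \<in> H"
      by (intro diff_in kernel_in_H)
    have "ip_norm ip ?k = D y"
      using k unfolding ip_norm_def D_def by (simp add: ip_diff_right kernel_in_H ip_kernel algebra_simps)
    moreover have "ip f ?k = f y - f x"
      using f by (simp add: ip_diff_right kernel_in_H ip_kernel)
    ultimately show ?thesis
      using Cauchy_Schwarz[OF f k] by simp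
  qed
  then have "((\<lambda>y. f y - f x) \<longlongrightarrow> 0) (at x)"
    by (intro Lim_null_comparison[OF _ lim]) (simp add: eventually_at_filter)
  then show "(f \<longlongrightarrow> f x) (at x within UNIV)"
    by (simp add: LIM_zero_iff)
qed

section \<open>Residuals of kernel sections over finite sets of basis vectors\<close>

locale rkhs_basis = rkhs H ip K
  for H :: "('x \<Rightarrow> 'f::real_or_complex) set" and ip K +
  fixes I :: "'i set" and e :: "'i \<Rightarrow> 'x \<Rightarrow> 'f"
  assumes basis: "orthonormal_basis H ip I e"
begin

lemma e_in: "n \<in> I \<Longrightarrow> e n \<in> H"
  and ip_e: "m \<in> I \<Longrightarrow> n \<in> I \<Longrightarrow> ip (e m) (e n) = (if m = n then 1 else 0)"
  and dense: "f \<in> H \<Longrightarrow> 0 < \<epsilon> \<Longrightarrow> \<exists>g\<in>fun_space.span (e ` I). ip_norm ip (f - g) < \<epsilon>"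
  using basis unfolding orthonormal_basis_def by blast+

definition residual :: "'i set \<Rightarrow> 'x \<Rightarrow> 'x \<Rightarrow> 'f" where
  "residual F y = (\<lambda>t. K t y) - (\<Sum>n\<in>F. fscale (scnj (e n y)) (e n))"

lemma residual_apply: "residual F y x = K x y - (\<Sum>n\<in>F. e n x * scnj (e n y))"
  by (simp add: residual_def sum_fun_apply fscale_def mult.commute)

lemma residual_in: "F \<subseteq> I \<Longrightarrow> residual F y \<in> H"
  unfolding residual_def by (intro diff_in kernel_in_H sum_in scale_in e_in) auto

lemma span_subset_H: "F \<subseteq> I \<Longrightarrow> fun_space.span (e ` F) \<subseteq> H"
  by (intro fun_space.span_minimal subspace_H) (auto intro: e_in)

text \<open>For m in \<open>F\<close>, both K_y and the subtracted sum have inner product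
  \<open>scnj (e m y)\<close> with \<open>e m\<close>: the former by the reproducing property, the
  latter by orthonormality.\<close>

lemma residual_orthogonal:
  assumes F: "finite F" "F \<subseteq> I" and h: "h \<in> fun_space.span (e ` F)"
  shows "ip (residual F y) h = 0"
proof -
  have "ip (residual F y) (e m) = 0" if m: "m \<in> F" for m
  proof -
    have mI: "m \<in> I" using m F by blast
    have inH: "(\<Sum>n\<in>F. fscale (scnj (e n y)) (e n)) \<in> H"
      using F by (intro sum_in scale_in e_in) auto
    have "ip (\<Sum>n\<in>F. fscale (scnj (e n y)) (e n)) (e m)
        = (\<Sum>n\<in>F. scnj (e n y) * ip (e n) (e m))"
      using F mI by (subst ip_sum_left) (auto intro!: scale_in e_in sum.cong ip_scale_left)
    also have "\<dots> = (\<Sum>n\<in>F. if n = m then scnj (e n y) else 0)"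
      using F mI by (intro sum.cong) (auto simp: ip_e)
    also have "\<dots> = scnj (e m y)"
      using F m by simp
    finally have "ip (\<Sum>n\<in>F. fscale (scnj (e n y)) (e n)) (e m) = scnj (e m y)" .
    moreover have "ip (\<lambda>t. K t y) (e m) = scnj (e m y)"
      using mI by (simp add: ip_commute[of "e m"] e_in kernel_in_H ip_kernel)
    ultimately show ?thesis
      unfolding residual_def using inH mI by (simp add: ip_diff_left kernel_in_H e_in)
  qed
  then have "e n \<in> H \<and> ip (e n) (residual F y) = 0" if "n \<in> F" for n
    using that F ip_commute[OF residual_in[OF F(2)] e_in, of n y] by (auto intro: e_in)
  then have "e ` F \<subseteq> {h \<in> H. ip h (residual F y) = 0}"
    by blast
  from fun_space.span_minimal[OF this subspace_orthogonal[OF residual_in[OF F(2)]]]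
  show ?thesis
    using h residual_in[OF F(2), of y] by (auto simp: ip_commute[of h])
qed

lemma projection_in_span: "(\<Sum>n\<in>F. fscale (c n) (e n)) \<in> fun_space.span (e ` F)"
  by (intro fun_space.span_sum fun_space.span_scale fun_space.span_base) auto

text \<open>The second argument is K_x minus an element of the span of \<open>e\<close> over
  \<open>F\<close>. That element is orthogonal to \<open>residual F y\<close>, so only the inner
  product with K_x remains, which is evaluation at x.\<close>

lemma ip_residual:
  assumes "finite F" "F \<subseteq> I"
  shows "ip (residual F y) (residual F x) = residual F y x"
proof -
  let ?g = "\<Sum>n\<in>F. fscale (scnj (e n x)) (e n)"
  have g: "?g \<in> fun_space.span (e ` F)"
    by (rule projection_in_span)
  then have gH: "?g \<in> H"
    using span_subset_H[OF assms(2)] by (rule rev_subsetD)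
  have "ip (residual F y) (residual F x) = ip (residual F y) (\<lambda>t. K t x) - ip (residual F y) ?g"
    unfolding residual_def[of F x]
    by (rule ip_diff_right[OF residual_in[OF assms(2)] kernel_in_H gH])
  also have "\<dots> = residual F y x"
    by (simp only: residual_orthogonal[OF assms g] ip_kernel[OF residual_in[OF assms(2)]] diff_zero)
  finally show ?thesis .
qed

text \<open>The squared norm of \<open>residual F x\<close> as a real number; K(x,x) = <K_x, K_x> is
  real and nonnegative, so it equals its own norm. In this form monotonicity in \<open>F\<close> and
  continuity in \<open>x\<close> are immediate.\<close>

definition err :: "'i set \<Rightarrow> 'x \<Rightarrow> real" where
  "err F x = norm (K x x) - (\<Sum>n\<in>F. (norm (e n x))\<^sup>2)"

lemma residual_norm_sq:
  assumes "finite F" "F \<subseteq> I"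
  shows "(ip_norm ip (residual F x))\<^sup>2 = err F x"
proof -
  have "K x x = ip (\<lambda>t. K t x) (\<lambda>t. K t x)"
    by (simp add: ip_kernel kernel_in_H)
  then have K: "K x x = of_real (norm (K x x))"
    using ip_self[OF kernel_in_H, of x] by (metis norm_of_real abs_power2)
  have "of_real ((ip_norm ip (residual F x))\<^sup>2) = residual F x x"
    by (simp only: ip_residual[OF assms] flip: ip_self[OF residual_in[OF assms(2)]])
  also have "\<dots> = of_real (err F x)"
    unfolding residual_apply err_def of_real_diff of_real_sum K[symmetric]
    by (simp add: mult_scnj_of_real)
  finally show ?thesis
    by (simp only: of_real_eq_iff)
qed

lemma err_nonneg:
  assumes "finite F" "F \<subseteq> I"
  shows "0 \<le> err F x"
  using residual_norm_sq[OF assms, of x] by (metis zero_le_power2)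

lemma partial_sum_error:
  assumes "finite F" "F \<subseteq> I"
  shows "norm (K x y - (\<Sum>n\<in>F. e n x * scnj (e n y))) \<le> sqrt (err F y * err F x)"
proof -
  have "norm (residual F y x) \<le> ip_norm ip (residual F y) * ip_norm ip (residual F x)"
    using Cauchy_Schwarz[OF residual_in[OF assms(2)] residual_in[OF assms(2)]]
    by (simp only: flip: ip_residual[OF assms])
  also have "\<dots> = sqrt (err F y * err F x)"
    by (simp add: real_sqrt_mult ip_norm_nonneg flip: residual_norm_sq[OF assms])
  finally show ?thesis
    by (simp add: residual_apply)
qed

lemma err_antimono: "finite G \<Longrightarrow> F \<subseteq> G \<Longrightarrow> err G x \<le> err F x"
  unfolding err_def by (intro diff_left_mono sum_mono2) auto

text \<open>Density provides a finite linear combination \<open>h\<close> close to K_x. With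
  \<open>F\<close> indexing the vectors in \<open>h\<close>, the residual is no longer than K_x - h,
  as orthogonal projection is the best approximation.\<close>

lemma ex_err_less:
  assumes "0 < \<epsilon>"
  shows "\<exists>F\<subseteq>I. finite F \<and> err F x < \<epsilon>"
proof -
  obtain h where h: "h \<in> fun_space.span (e ` I)"
    and less: "ip_norm ip ((\<lambda>t. K t x) - h) < sqrt \<epsilon>"
    using dense[OF kernel_in_H, of "sqrt \<epsilon>" x] assms by auto
  obtain T r where T: "finite T" "T \<subseteq> e ` I" and h_eq: "h = (\<Sum>a\<in>T. fscale (r a) a)"
    using h unfolding fun_space.span_explicit by auto
  obtain F where F: "F \<subseteq> I" "finite F" "T = e ` F"
    using finite_subset_image[OF T] by blast
  have hF: "h \<in> fun_space.span (e ` F)"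
    unfolding h_eq F(3)[symmetric]
    by (intro fun_space.span_sum fun_space.span_scale fun_space.span_base)
  have hH: "h \<in> H"
    using hF span_subset_H[OF F(1)] by blast
  let ?R = "residual F x" and ?d = "(\<lambda>t. K t x) - h"
  have dH: "?d \<in> H"
    by (intro diff_in kernel_in_H hH)
  \<comment> \<open>Since \<open>h\<close> is orthogonal to the residual, <R, K_x - h> = <R, K_x> =
    R(x), which is the squared norm of R. Cauchy-Schwarz and cancelling one factor then compare the
    two norms.\<close>
  have "ip ?R ?d = ?R x"
    using F hH by (simp add: ip_diff_right residual_in kernel_in_H ip_kernel
        residual_orthogonal[OF F(2,1) hF])
  also have "\<dots> = of_real ((ip_norm ip ?R)\<^sup>2)"
    by (simp only: ip_residual[OF F(2,1)] flip: ip_self[OF residual_in[OF F(1)]])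
  finally have "(ip_norm ip ?R)\<^sup>2 \<le> ip_norm ip ?R * ip_norm ip ?d"
    using Cauchy_Schwarz[OF residual_in[OF F(1)] dH, of x] by (simp add: norm_power)
  then have "ip_norm ip ?R \<le> ip_norm ip ?d"
    using ip_norm_nonneg[of ?R] ip_norm_nonneg[of ?d]
    by (cases "ip_norm ip ?R = 0") (auto simp: power2_eq_square)
  then have "(ip_norm ip ?R)\<^sup>2 < (sqrt \<epsilon>)\<^sup>2"
    using less by (intro power_strict_mono) (auto simp: ip_norm_nonneg)
  then have "err F x < \<epsilon>"
    using assms by (simp add: residual_norm_sq[OF F(2,1)])
  then show ?thesis using F by blast
qed

lemma err_tendsto_0: "((\<lambda>F. err F x) \<longlongrightarrow> 0) (finite_subsets_at_top I)"
proof (rule order_tendstoI)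
  fix a :: real assume "a < 0"
  then show "\<forall>\<^sub>F F in finite_subsets_at_top I. a < err F x"
    by (intro eventually_finite_subsets_at_top_weakI) (use err_nonneg in \<open>meson less_le_trans\<close>)
next
  fix a :: real assume "0 < a"
  then obtain F where F: "F \<subseteq> I" "finite F" "err F x < a"
    using ex_err_less by blast
  have "err G x < a" if "finite G" "F \<subseteq> G" for G
    using err_antimono[OF that] F(3) by (rule le_less_trans)
  with F have "\<exists>X. finite X \<and> X \<subseteq> I \<and> (\<forall>Y. finite Y \<and> X \<subseteq> Y \<and> Y \<subseteq> I \<longrightarrow> err Y x < a)"
    by (intro exI[of _ F]) simp
  then show "\<forall>\<^sub>F F in finite_subsets_at_top I. err F x < a"
    by (simp only: eventually_finite_subsets_at_top)
qed

section \<open>Pointwise, absolute and uniform convergence of the expansion\<close>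

lemma kernel_has_sum: "((\<lambda>n. e n x * scnj (e n y)) has_sum K x y) I"
  unfolding has_sum_def
proof (rule LIM_zero_cancel, rule Lim_null_comparison)
  show "\<forall>\<^sub>F F in finite_subsets_at_top I.
      norm ((\<Sum>n\<in>F. e n x * scnj (e n y)) - K x y) \<le> sqrt (err F y * err F x)"
    by (intro eventually_finite_subsets_at_top_weakI) (simp add: norm_minus_commute partial_sum_error)
  show "((\<lambda>F. sqrt (err F y * err F x)) \<longlongrightarrow> 0) (finite_subsets_at_top I)"
    using tendsto_real_sqrt[OF tendsto_mult[OF err_tendsto_0[of y] err_tendsto_0[of x]]] by simp
qed

text \<open>Nonnegativity of \<open>err\<close> is Bessel's inequality: finite sums of |e_n(z)|^2
  are bounded by K(z,z). The product terms are dominated by the sum of two such families.\<close>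

lemma kernel_abs_summable: "(\<lambda>n. e n x * scnj (e n y)) abs_summable_on I"
proof (rule Infinite_Sum.abs_summable_on_comparison_test')
  have "(\<lambda>n. (norm (e n z))\<^sup>2) summable_on I" for z
  proof (rule nonneg_bdd_above_summable_on)
    show "bdd_above (sum (\<lambda>n. (norm (e n z))\<^sup>2) ` {F. F \<subseteq> I \<and> finite F})"
      using err_nonneg[of _ z] by (intro bdd_aboveI[of _ "norm (K z z)"]) (auto simp: err_def)
  qed simp
  then show "(\<lambda>n. (norm (e n x))\<^sup>2 + (norm (e n y))\<^sup>2) summable_on I"
    by (intro summable_on_add)
  show "norm (e n x * scnj (e n y)) \<le> (norm (e n x))\<^sup>2 + (norm (e n y))\<^sup>2" for n
  proof -
    have "norm (e n x) * norm (e n y) \<ge> 0" by simp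
    with sum_squares_bound[of "norm (e n x)" "norm (e n y)"] show ?thesis
      unfolding norm_mult norm_scnj mult.assoc by linarith
  qed
qed

end

text \<open>Dini's argument: the sets where \<open>E N\<close> is below \<epsilon> are open,
  increase with \<open>N\<close> and cover the compact space, so a single one of them is already
  everything.\<close>

lemma kernel_expansion_uniform_limit:
  fixes K :: "'x::topological_space \<Rightarrow> 'x \<Rightarrow> 'f::real_or_complex" and I :: "nat set"
  assumes compact: "compact (UNIV :: 'x set)"
    and cont: "continuous_on UNIV (\<lambda>(x, y). K x y)"
    and "rkhs_basis H ip K I e"
  shows "uniform_limit UNIV (\<lambda>N (x, y). \<Sum>n\<in>I \<inter> {..<N}. e n x * scnj (e n y))
      (\<lambda>(x, y). K x y) sequentially"
proof (rule uniform_limitI)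
  interpret rkhs_basis H ip K I e by fact
  fix \<epsilon> :: real assume \<epsilon>: "0 < \<epsilon>"
  define E where "E N = err (I \<inter> {..<N})" for N
  have E_antimono: "E N x \<le> E M x" if "M \<le> N" for M N x
    unfolding E_def using that by (intro err_antimono) auto
  have "continuous_on UNIV (\<lambda>x. K x x)"
    using continuous_on_compose2[OF cont continuous_on_Pair[OF continuous_on_id continuous_on_id]]
    by simp
  moreover have "continuous_on UNIV (e n)" if "n \<in> I" for n
    by (rule continuous_on_in_H[OF rkhs_axioms cont e_in[OF that]])
  ultimately have "continuous_on UNIV (E N)" for N
    unfolding E_def err_def by (intro continuous_intros) auto
  then have op: "open {x. E N x < \<epsilon>}" for N
    by (intro open_Collect_less continuous_on_const)
  have "\<exists>N. E N x < \<epsilon>" for x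
  proof -
    obtain F where F: "F \<subseteq> I" "finite F" "err F x < \<epsilon>"
      using ex_err_less[OF \<epsilon>] by blast
    obtain N where "F \<subseteq> {..<N}"
      using finite_nat_bounded[OF F(2)] by auto
    then have "E N x \<le> err F x"
      unfolding E_def using F by (intro err_antimono) auto
    then show ?thesis using F(3) by (intro exI[of _ N]) simp
  qed
  then have cover: "UNIV \<subseteq> (\<Union>N\<in>UNIV. {x. E N x < \<epsilon>})"
    by auto
  obtain C where C: "finite C" "UNIV \<subseteq> (\<Union>N\<in>C. {x. E N x < \<epsilon>})"
    by (rule compactE_image[where f = "\<lambda>N. {x. E N x < \<epsilon>}", OF compact op cover])
  \<comment> \<open>\<open>M\<close> exceeds every index of the finite subcover. As
    \<open>E N x\<close> decreases in \<open>N\<close>, the bound holding at x for some index in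
    \<open>C\<close> persists for all \<open>N\<close> from \<open>M\<close> on.\<close>
  obtain M where "C \<subseteq> {..<M}"
    using finite_nat_bounded[OF C(1)] by auto
  then have E_less: "E N x < \<epsilon>" if "M \<le> N" for N x
  proof -
    obtain m where "m \<in> C" "E m x < \<epsilon>"
      using C(2) by blast
    moreover from this have "m \<le> N"
      using \<open>C \<subseteq> {..<M}\<close> that by force
    ultimately show ?thesis
      using E_antimono[of m N x] by simp
  qed
  have "norm (K x y - (\<Sum>n\<in>I \<inter> {..<N}. e n x * scnj (e n y))) < \<epsilon>" if "M \<le> N" for N x y
  proof -
    \<comment> \<open>The error at (x,y) is controlled by the diagonal errors at x and y, so
      uniformity on the space gives uniformity on its square.\<close>
    have "norm (K x y - (\<Sum>n\<in>I \<inter> {..<N}. e n x * scnj (e n y))) \<le> sqrt (E N y * E N x)"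
      unfolding E_def by (intro partial_sum_error) auto
    also have "\<dots> < sqrt (\<epsilon> * \<epsilon>)"
      using E_less[OF that] \<epsilon> err_nonneg[of "I \<inter> {..<N}"]
      by (intro real_sqrt_less_mono mult_strict_mono) (auto simp: E_def)
    finally show ?thesis using \<epsilon> by simp
  qed
  then show "\<forall>\<^sub>F N in sequentially. \<forall>p\<in>UNIV.
      dist (case p of (x, y) \<Rightarrow> \<Sum>n\<in>I \<inter> {..<N}. e n x * scnj (e n y)) (case p of (x, y) \<Rightarrow> K x y) < \<epsilon>"
    unfolding eventually_sequentially by (intro exI[of _ M]) (auto simp: dist_norm norm_minus_commute)
qed

theorem theorem4p13:
  fixes K :: "'x::metric_space \<Rightarrow> 'x \<Rightarrow> 'f::real_or_complex"
    and H :: "('x \<Rightarrow> 'f) set"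
    and ip :: "('x \<Rightarrow> 'f) \<Rightarrow> ('x \<Rightarrow> 'f) \<Rightarrow> 'f"
    and I :: "nat set"
    and e :: "nat \<Rightarrow> 'x \<Rightarrow> 'f"
  assumes "compact (UNIV :: 'x set)"
    and "mercer_kernel K"
    and "rkhs H ip K"
    and "I = UNIV \<or> (\<exists>d. I = {..<d})"
    and "orthonormal_basis H ip I e"
  shows "(\<forall>x y. K x y = (\<Sum>\<^sub>\<infinity>n\<in>I. e n x * scnj (e n y))) \<and>
    (\<forall>x y. (\<lambda>n. e n x * scnj (e n y)) abs_summable_on I) \<and>
    uniform_limit UNIV (\<lambda>N (x, y). \<Sum>n\<in>I \<inter> {..<N}. e n x * scnj (e n y))
      (\<lambda>(x, y). K x y) sequentially"
proof -
  have basis: "rkhs_basis H ip K I e"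
    using assms(3,5) by (simp add: rkhs_basis_def rkhs_basis_axioms_def)
  have "continuous_on UNIV (\<lambda>(x, y). K x y)"
    using assms(2) by (simp add: mercer_kernel_def)
  note uniform = kernel_expansion_uniform_limit[OF assms(1) this basis]
  \<comment> \<open>\<open>infsum\<close> defaults to 0 for families without a sum; the equation
    comes from \<open>has_sum\<close>, hence from actual convergence.\<close>
  have "K x y = (\<Sum>\<^sub>\<infinity>n\<in>I. e n x * scnj (e n y))" for x y
    by (rule infsumI[OF rkhs_basis.kernel_has_sum[OF basis], symmetric])
  moreover have "(\<lambda>n. norm (e n x * scnj (e n y))) summable_on I" for x y
    by (rule rkhs_basis.kernel_abs_summable[OF basis])
  ultimately show ?thesis
    using uniform by blast
qed

end
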